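(* Let $P_T>0$, $\sigma^2>0$, let $g_{ji}>0$ for $i,j\in\{1,2,3\}$, and fix $P_1\in[0,P_T]$. Put $\bar P=P_T-P_1$ and define $$a_1=\frac{g_{22}}{g_{12}P_1+\sigma^2},\quad b_1=\frac{g_{32}}{g_{12}P_1+\sigma^2},\quad c_1=\frac{g_{23}}{g_{13}P_1+\sigma^2},\quad d_1=\frac{g_{33}}{g_{13}P_1+\sigma^2},$$ $$e_1=\frac{g_{11}P_1}{\sigma^2},\quad f_1=\frac{g_{21}}{\sigma^2},\quad h_1=\frac{g_{31}}{\sigma^2}.$$ Consider the maximization of $$\mathcal{C}(P_2,P_3)=\log_2\Big(1+\frac{a_1P_2}{b_1P_3+1}\Big)+\log_2\Big(1+\frac{d_1P_3}{c_1P_2+1}\Big)+\log_2\Big(1+\frac{e_1}{f_1P_2+h_1P_3+1}\Big)$$ over all $P_2,P_3\ge 0$ with $P_2+P_3=\bar P$. If $(P_2^*,P_3^* )$ is an optimal pair, then either $(P_2^*,P_3^* )=(0,\bar P)$, or $(P_2^*,P_3^* )=(\bar P,0)$, or $P_2^*=\bar P-P_3^*$ and $P_3^*$ is a solution of the equation $$A_1P_3^4+B_1P_3^3+C_1P_3^2+D_1P_3+E_1=0,$$ where, with $$a_1'=a_1\bar P+1,\quad b_1'=b_1-a_1,\quad c_1'=c_1\bar P+1,\quad d_1'=d_1-c_1,$$ $$e_1'=f_1\bar P+e_1+1,\quad f_1'=f_1\bar P+1,\quad h_1'=h_1-f_1,$$ the coefficients are $$A_1=a_1'b_1c_1d_1'h_1'^2-b_1'c_1d_1'h_1'^2+b_1b_1'c_1c_1'h_1'^2+b_1b_1'c_1'd_1'h_1'^2+b_1b_1'c_1d_1'e_1'h_1'-b_1b_1'c_1d_1'f_1'h_1',$$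 $$B_1=2b_1'c_1'd_1'h_1'^2-2b_1'c_1d_1'f_1'h_1'+2a_1'b_1c_1c_1'h_1'^2+2a_1'b_1c_1d_1'e_1'h_1'+2b_1b_1'c_1c_1'e_1'h_1'+2b_1b_1'c_1'd_1'f_1'h_1',$$ $$\begin{aligned}C_1={}&b_1'c_1'^2h_1'^2+a_1'c_1c_1'h_1'^2+a_1'c_1'd_1'h_1'^2-a_1'b_1c_1'^2h_1'^2-b_1'c_1d_1'e_1'f_1'+a_1'c_1d_1'e_1'h_1'\\&+b_1'c_1c_1'e_1'h_1'-a_1'c_1d_1'f_1'h_1'-b_1'c_1c_1'f_1'h_1'+b_1'c_1'd_1'e_1'h_1'+3b_1'c_1'd_1'f_1'h_1'-b_1b_1'c_1'^2e_1'h_1'\\&+b_1b_1'c_1'^2f_1'h_1'+a_1'b_1c_1d_1'e_1'f_1'+b_1b_1'c_1c_1'e_1'f_1'+3a_1'b_1c_1c_1'e_1'h_1'+b_1b_1'c_1'd_1'e_1'f_1'\\&+a_1'b_1c_1c_1'f_1'h_1'-a_1'b_1c_1'd_1'e_1'h_1'+a_1'b_1c_1'd_1'f_1'h_1',\end{aligned}$$ $$D_1=2b_1'c_1'^2f_1'h_1'+2a_1'c_1c_1'e_1'h_1'+2b_1'c_1'd_1'e_1'f_1'+2a_1'c_1'd_1'f_1'h_1'-2a_1'b_1c_1'^2e_1'h_1'+2a_1'b_1c_1c_1'e_1'f_1',$$ $$E_1=b_1'c_1'^2e_1'f_1'-a_1'c_1'^2e_1'h_1'+a_1'c_1'^2f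_1'h_1'+a_1'c_1c_1'e_1'f_1'+a_1'c_1'd_1'e_1'f_1'-a_1'b_1c_1'^2e_1'f_1'.$$
   Context: Setting: three transmitter-receiver (TX-RX) pairs share one frequency band and a total power budget $P_T$. $g_{ji}$ is the channel gain from TX $j$ to RX $i$, $\sigma^2$ is the noise power, and $P_i$ is the power allocated to TX $i$. The sum rate is $\sum_{i=1}^3\log_2\big(1+\frac{g_{ii}P_i}{\sum_{j\ne i}g_{ji}P_j+\sigma^2}\big)$. For fixed $P_1$ it equals the function $\mathcal{C}(P_2,P_3)$ of the claim, and the remaining power $\bar P=P_T-P_1$ is allocated between TX 2 and TX 3. Primes on symbols denote new constants, not derivatives, and $h_1'^2$ means $(h_1')^2$ (similarly for $c_1'^2$). *)

theory Defs imports Complex_Main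
begin

end

theory Submission imports Defs begin

text \<open>
  On the segment \<open>P\<^sub>2 = Pbar - t\<close>, \<open>P\<^sub>3 = t\<close> each of the three rates is the logarithm of
  a quotient of two positive affine functions of \<open>t\<close>. At an optimal pair with both powers
  positive the derivative in \<open>t\<close> vanishes, and clearing the six affine denominators gives the
  quartic; its degree is four rather than five because \<open>ln ((p + q t) / (r + s t))\<close> has
  the derivative \<open>(q r - p s) / ((p + q t) (r + s t))\<close>, whose numerator is constant.
\<close>

text \<open>In the quotient rule \<open>q * (r + s * x) - (p + q * x) * s\<close> collapses to
  \<open>q * r - p * s\<close>, and dividing by the quotient itself cancels one factor
  \<open>r + s * x\<close>. The divisor \<open>ln c\<close> is kept separate so that it can later be
  dropped from a whole sum.\<close>

lemma DERIV_log_affine_quotient: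
  fixes p q r s x c :: real
  assumes "p + q * x > 0" and "r + s * x > 0"
  shows "((\<lambda>t. log c ((p + q * t) / (r + s * t))) has_real_derivative
           (q * r - p * s) / ((p + q * x) * (r + s * x)) / ln c) (at x)"
proof -
  have "((\<lambda>t. ln ((p + q * t) / (r + s * t))) has_real_derivative
           (q * r - p * s) / ((p + q * x) * (r + s * x))) (at x)"
    using assms by (auto intro!: derivative_eq_intros simp: divide_simps) (simp add: algebra_simps)
  then show ?thesis
    unfolding log_def by (rule DERIV_cdivide)
qed

lemma sum_of_three_fractions_eq_0:
  fixes u1 u2 u3 v1 v2 v3 :: real
  assumes "u1 / v1 + u2 / v2 + u3 / v3 = 0" and "v1 \<noteq> 0" "v2 \<noteq> 0" "v3 \<noteq> 0"
  shows "u1 * v2 * v3 + u2 * v1 * v3 + u3 * v1 * v2 = 0"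
  using assms by (simp add: field_simps)

theorem theorem4:
  fixes P_T P1 Pbar \<sigma> :: real
    and g :: "nat \<Rightarrow> nat \<Rightarrow> real"
    and a1 b1 c1 d1 e1 f1 h1 :: real
    and a1' b1' c1' d1' e1' f1' h1' :: real
    and A1 B1 C1 D1 E1 :: real
    and C :: "real \<Rightarrow> real \<Rightarrow> real"
    and P2s P3s :: real
  assumes "P_T > 0" and "\<sigma>\<^sup>2 > 0"
    and "\<forall>j\<in>{1,2,3}. \<forall>i\<in>{1,2,3}. g j i > 0"
    and "P1 \<in> {0..P_T}"
    and "Pbar = P_T - P1"
    and "a1 = g 2 2 / (g 1 2 * P1 + \<sigma>\<^sup>2)"
    and "b1 = g 3 2 / (g 1 2 * P1 + \<sigma>\<^sup>2)"
    and "c1 = g 2 3 / (g 1 3 * P1 + \<sigma>\<^sup>2)"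
    and "d1 = g 3 3 / (g 1 3 * P1 + \<sigma>\<^sup>2)"
    and "e1 = g 1 1 * P1 / \<sigma>\<^sup>2"
    and "f1 = g 2 1 / \<sigma>\<^sup>2"
    and "h1 = g 3 1 / \<sigma>\<^sup>2"
    and "C = (\<lambda>P2 P3. log 2 (1 + a1 * P2 / (b1 * P3 + 1))
                  + log 2 (1 + d1 * P3 / (c1 * P2 + 1))
                  + log 2 (1 + e1 / (f1 * P2 + h1 * P3 + 1)))"
    and "a1' = a1 * Pbar + 1" and "b1' = b1 - a1"
    and "c1' = c1 * Pbar + 1" and "d1' = d1 - c1"
    and "e1' = f1 * Pbar + e1 + 1" and "f1' = f1 * Pbar + 1"
    and "h1' = h1 - f1"
    and "A1 = a1' * b1 * c1 * d1' * h1'\<^sup>2 - b1' * c1 * d1' * h1'\<^sup>2 + b1 * b1' * c1 * c1' * h1'\<^sup>2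
          + b1 * b1' * c1' * d1' * h1'\<^sup>2 + b1 * b1' * c1 * d1' * e1' * h1' - b1 * b1' * c1 * d1' * f1' * h1'"
    and "B1 = 2 * b1' * c1' * d1' * h1'\<^sup>2 - 2 * b1' * c1 * d1' * f1' * h1' + 2 * a1' * b1 * c1 * c1' * h1'\<^sup>2
          + 2 * a1' * b1 * c1 * d1' * e1' * h1' + 2 * b1 * b1' * c1 * c1' * e1' * h1' + 2 * b1 * b1' * c1' * d1' * f1' * h1'"
    and "C1 = b1' * c1'\<^sup>2 * h1'\<^sup>2 + a1' * c1 * c1' * h1'\<^sup>2 + a1' * c1' * d1' * h1'\<^sup>2
          - a1' * b1 * c1'\<^sup>2 * h1'\<^sup>2 - b1' * c1 * d1' * e1' * f1' + a1' * c1 * d1' * e1' * h1'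
          + b1' * c1 * c1' * e1' * h1' - a1' * c1 * d1' * f1' * h1' - b1' * c1 * c1' * f1' * h1'
          + b1' * c1' * d1' * e1' * h1' + 3 * b1' * c1' * d1' * f1' * h1' - b1 * b1' * c1'\<^sup>2 * e1' * h1'
          + b1 * b1' * c1'\<^sup>2 * f1' * h1' + a1' * b1 * c1 * d1' * e1' * f1' + b1 * b1' * c1 * c1' * e1' * f1'
          + 3 * a1' * b1 * c1 * c1' * e1' * h1' + b1 * b1' * c1' * d1' * e1' * f1' + a1' * b1 * c1 * c1' * f1' * h1'
          - a1' * b1 * c1' * d1' * e1' * h1' + a1' * b1 * c1' * d1' * f1' * h1'"
    and "D1 = 2 * b1' * c1'\<^sup>2 * f1' * h1' + 2 * a1' * c1 * c1' * e1' * h1' + 2 * b1' * c1' * d1' * e1' * f1'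
          + 2 * a1' * c1' * d1' * f1' * h1' - 2 * a1' * b1 * c1'\<^sup>2 * e1' * h1' + 2 * a1' * b1 * c1 * c1' * e1' * f1'"
    and "E1 = b1' * c1'\<^sup>2 * e1' * f1' - a1' * c1'\<^sup>2 * e1' * h1' + a1' * c1'\<^sup>2 * f1' * h1'
          + a1' * c1 * c1' * e1' * f1' + a1' * c1' * d1' * e1' * f1' - a1' * b1 * c1'\<^sup>2 * e1' * f1'"
    and "is_arg_max (\<lambda>(P2, P3). C P2 P3)
           (\<lambda>(P2, P3). P2 \<ge> 0 \<and> P3 \<ge> 0 \<and> P2 + P3 = Pbar) (P2s, P3s)"
  shows "(P2s, P3s) = (0, Pbar) \<or> (P2s, P3s) = (Pbar, 0) \<or>
         (P2s = Pbar - P3s \<and>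
          A1 * P3s ^ 4 + B1 * P3s ^ 3 + C1 * P3s\<^sup>2 + D1 * P3s + E1 = 0)"
proof (cases "P2s = 0 \<or> P3s = 0")
  case True
  then show ?thesis
    using assms(26) by (auto simp: is_arg_max_def)
next
  case False
  have max: "C y z \<le> C P2s P3s" if "y \<ge> 0" "z \<ge> 0" "y + z = Pbar" for y z
    using assms(26) that by (fastforce simp: is_arg_max_def not_less)
  have P2s: "P2s = Pbar - P3s" and x: "P3s > 0" "P3s < Pbar"
    using assms(26) False by (auto simp: is_arg_max_def)
  have gpos: "g j i > 0" if "j \<in> {1, 2, 3}" "i \<in> {1, 2, 3}" for j i
    using assms(3) that by blast
  have P1: "P1 \<ge> 0"
    using assms(4) by simp
  \<comment> \<open>\<open>e1\<close> is only nonnegative, since \<open>P1\<close> may be 0.\<close>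
  have pos: "a1 > 0" "b1 > 0" "c1 > 0" "d1 > 0" "e1 \<ge> 0" "f1 > 0" "h1 > 0"
    unfolding assms(6-12) using P1 assms(2)
    by (simp_all add: gpos add_nonneg_pos less_imp_le)
  \<comment> \<open>The primed constants are the coefficients of these affine functions. On the
    right each one is a sum of terms that are visibly nonnegative on the segment, with a summand 1
    that makes it strictly positive.\<close>
  have affine:
    "a1' + b1' * t = b1 * t + 1 + a1 * (Pbar - t)"
    "c1' + d1' * t = c1 * (Pbar - t) + 1 + d1 * t"
    "c1' + (- c1) * t = c1 * (Pbar - t) + 1"
    "e1' + h1' * t = f1 * (Pbar - t) + h1 * t + 1 + e1"
    "f1' + h1' * t = f1 * (Pbar - t) + h1 * t + 1" for t
    unfolding assms(14-20) by (simp_all add: algebra_simps)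
  have affine_pos:
    "a1' + b1' * t > 0" "1 + b1 * t > 0" "c1' + d1' * t > 0" "c1' + (- c1) * t > 0"
    "e1' + h1' * t > 0" "f1' + h1' * t > 0" if "0 \<le> t" "t \<le> Pbar" for t
    unfolding affine using that pos by (simp_all add: add_nonneg_pos add_pos_nonneg)
  \<comment> \<open>The objective along the segment, with \<open>- c1\<close> as an explicit slope
    so that all three quotients fit the derivative lemma.\<close>
  define G where "G t = log 2 ((a1' + b1' * t) / (1 + b1 * t))
      + log 2 ((c1' + d1' * t) / (c1' + (- c1) * t))
      + log 2 ((e1' + h1' * t) / (f1' + h1' * t))" for t
  have C_eq_G: "C (Pbar - t) t = G t" if "0 \<le> t" "t \<le> Pbar" for t
  proof -
    have "1 + a1 * (Pbar - t) / (b1 * t + 1) = (a1' + b1' * t) / (1 + b1 * t)"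
      using affine_pos(2)[OF that] unfolding affine by (simp add: field_simps)
    moreover have "1 + d1 * t / (c1 * (Pbar - t) + 1) = (c1' + d1' * t) / (c1' + (- c1) * t)"
      using affine_pos(4)[OF that] unfolding affine by (simp add: add_divide_distrib)
    moreover have "1 + e1 / (f1 * (Pbar - t) + h1 * t + 1) = (e1' + h1' * t) / (f1' + h1' * t)"
      using affine_pos(6)[OF that] unfolding affine by (simp add: add_divide_distrib)
    ultimately show ?thesis
      unfolding assms(13) G_def by simp
  qed
  define v1 where "v1 = (a1' + b1' * P3s) * (1 + b1 * P3s)"
  define v2 where "v2 = (c1' + d1' * P3s) * (c1' + (- c1) * P3s)"
  define v3 where "v3 = (e1' + h1' * P3s) * (f1' + h1' * P3s)"
  \<comment> \<open>The numerators \<open>q * r - p * s\<close> of the three derivatives, left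
    unsimplified to match the lemma literally.\<close>
  define u1 where "u1 = b1' * 1 - a1' * b1"
  define u2 where "u2 = d1' * c1' - c1' * (- c1)"
  define u3 where "u3 = h1' * f1' - e1' * h1'"
  have nz: "v1 \<noteq> 0" "v2 \<noteq> 0" "v3 \<noteq> 0"
    unfolding v1_def v2_def v3_def using affine_pos[of P3s] x by simp_all
  have "(G has_real_derivative u1 / v1 / ln 2 + u2 / v2 / ln 2 + u3 / v3 / ln 2) (at P3s)"
    unfolding G_def u1_def u2_def u3_def v1_def v2_def v3_def
    by (intro DERIV_add DERIV_log_affine_quotient affine_pos) (use x in simp_all)
  \<comment> \<open>This radius keeps \<open>y\<close> inside the segment, where \<open>G\<close>
    agrees with the objective and global optimality applies.\<close>
  moreover have "\<forall>y. \<bar>P3s - y\<bar> < min P3s (Pbar - P3s) \<longrightarrow> G y \<le> G P3s"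
  proof (intro allI impI)
    fix y assume "\<bar>P3s - y\<bar> < min P3s (Pbar - P3s)"
    then have "0 \<le> y" "y \<le> Pbar"
      by linarith+
    then show "G y \<le> G P3s"
      using max[of "Pbar - y" y] C_eq_G[of y] C_eq_G[of P3s] x P2s by simp
  qed
  ultimately have "u1 / v1 / ln 2 + u2 / v2 / ln 2 + u3 / v3 / ln 2 = 0"
    using DERIV_local_max[of G _ P3s "min P3s (Pbar - P3s)"] x by simp
  then have "(u1 / v1 + u2 / v2 + u3 / v3) / ln 2 = 0"
    by (simp only: add_divide_distrib)
  then have "u1 / v1 + u2 / v2 + u3 / v3 = 0"
    by simp
  then have "u1 * v2 * v3 + u2 * v1 * v3 + u3 * v1 * v2 = 0"
    using nz by (rule sum_of_three_fractions_eq_0)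
  \<comment> \<open>Each \<open>u\<close> is constant and each \<open>v\<close> quadratic in
    \<open>P3s\<close>, so every product has degree at most four. The identity holds with the primed
    constants as independent indeterminates, so their definitions stay folded.\<close>
  also have "u1 * v2 * v3 + u2 * v1 * v3 + u3 * v1 * v2
      = A1 * P3s ^ 4 + B1 * P3s ^ 3 + C1 * P3s\<^sup>2 + D1 * P3s + E1"
    unfolding u1_def u2_def u3_def v1_def v2_def v3_def assms(21-25)
    by algebra
  finally show ?thesis
    using P2s by simp
qed

end
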